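(* Every tree $G$ with $|V(G)|\ge 3$ is neither $\omega$-unfrozen nor $\chi$-unfrozen.
   Context: Graphs are finite, undirected, simple, without loops. A tree is a connected graph without cycles. $\omega(G)$ is the size of a maximum clique and $\chi(G)$ the chromatic number. A nonedge of $G$ is a pair $e=\{u,v\}$ of distinct vertices with $e\notin E(G)$; $G+e$ is $G$ with $e$ added as an edge. For a parameter $\xi$, $G$ is $\xi$-unfrozen if $\xi(G+e)=\xi(G)$ for every nonedge $e$ of $G$. *)

theory Defs
  imports "Graph_Theory.Graph_Theory"
begin

text \<open>
  Finite simple undirected graphs are the digraphs satisfying \<open>pair_graph\<close>: finite, loop-free and
  symmetric, where an undirected edge between \<open>u\<close> and \<open>v\<close> is the pair of opposite arcs \<open>(u, v)\<close>
  and \<open>(v, u)\<close>.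

  The constants \<open>forest\<close> and \<open>tree\<close> of \<open>Digraph_Component\<close> cannot be used for such graphs, because
  traversing one edge back and forth is a cycle of length 2 in a symmetric digraph. An undirected
  cycle is a directed cycle (closed walk without repeated vertices) of length at least 3.
\<close>

definition undirected_cycle :: "'a pair_pre_digraph \<Rightarrow> ('a \<times> 'a) awalk \<Rightarrow> bool" where
  "undirected_cycle G p \<longleftrightarrow> pre_digraph.cycle (with_proj G) p \<and> 3 \<le> length p"

definition undirected_tree :: "'a pair_pre_digraph \<Rightarrow> bool" where
  "undirected_tree G \<longleftrightarrow> connected (with_proj G) \<and> \<not> (\<exists>p. undirected_cycle G p)"

definition clique :: "'a pair_pre_digraph \<Rightarrow> 'a set \<Rightarrow> bool" where
  "clique G C \<longleftrightarrow> C \<subseteq> pverts G \<and> (\<forall>u\<in>C. \<forall>v\<in>C. u \<noteq> v \<longrightarrow> (u, v) \<in> parcs G)"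

definition clique_number :: "'a pair_pre_digraph \<Rightarrow> nat" where
  "clique_number G = Max {card C | C. clique G C}"

definition proper_coloring :: "'a pair_pre_digraph \<Rightarrow> nat \<Rightarrow> ('a \<Rightarrow> nat) \<Rightarrow> bool" where
  "proper_coloring G k c \<longleftrightarrow> c ` pverts G \<subseteq> {..<k} \<and> (\<forall>(u, v)\<in>parcs G. c u \<noteq> c v)"

definition chromatic_number :: "'a pair_pre_digraph \<Rightarrow> nat" where
  "chromatic_number G = (LEAST k. \<exists>c. proper_coloring G k c)"

definition nonedge :: "'a pair_pre_digraph \<Rightarrow> 'a \<Rightarrow> 'a \<Rightarrow> bool" where
  "nonedge G u v \<longleftrightarrow> u \<in> pverts G \<and> v \<in> pverts G \<and> u \<noteq> v \<and> (u, v) \<notin> parcs G"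

definition add_edge :: "'a pair_pre_digraph \<Rightarrow> 'a \<Rightarrow> 'a \<Rightarrow> 'a pair_pre_digraph" where
  "add_edge G u v = G\<lparr>parcs := parcs G \<union> {(u, v), (v, u)}\<rparr>"

definition unfrozen :: "('a pair_pre_digraph \<Rightarrow> 'b) \<Rightarrow> 'a pair_pre_digraph \<Rightarrow> bool" where
  "unfrozen \<xi> G \<longleftrightarrow> (\<forall>u v. nonedge G u v \<longrightarrow> \<xi> (add_edge G u v) = \<xi> G)"

lemma pair_graph_add_edge:
  assumes "pair_graph G" "nonedge G u v"
  shows "pair_graph (add_edge G u v)"
proof -
  interpret pair_graph G by fact
  have "sym (parcs G)" using sym_arcs by (simp add: symmetric_def)
  then show ?thesis
    using assms(2)
    by unfold_locales
      (auto simp: add_edge_def nonedge_def symmetric_def sym_def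
        dest: in_arcsD1 in_arcsD2 pair_no_loops intro: pair_finite_verts pair_finite_arcs)
qed

end

theory Submission
  imports Defs
begin

text \<open>
  A tree with at least three vertices contains a path \<open>x - y - z\<close>, whose ends form a nonedge, since a
  tree has no triangle. Adding the edge \<open>xz\<close> creates a triangle, so both parameters become at
  least 3. In the tree both are at most 2: there is no triangle, and colouring the vertices by the
  parity of a walk from a fixed root is proper, since otherwise there would be a closed walk of
  odd length and hence an odd cycle.
\<close>

text \<open>If a vertex repeats, cutting there splits the walk into two shorter closed walks. Their
  lengths add up to an odd number, so one of them is odd and the induction applies to it.\<close>

lemma (in wf_digraph) odd_closed_awalk_imp_odd_cycle:
  assumes "awalk u p u" "odd (length p)"
  shows "\<exists>c. cycle c \<and> odd (length c)"
  using assms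
proof (induction "length p" arbitrary: u p rule: less_induct)
  case less
  then obtain e es where p: "p = e # es" by (cases p) auto
  with less.prems have e: "e \<in> arcs G" "u = tail G e" "awalk (head G e) es u"
    by (auto simp: awalk_Cons_iff)
  show ?case
  \<comment> \<open>Dropping the first vertex of \<open>p\<close> leaves exactly this list, so the
    return to \<open>u\<close> at the end does not count as a repetition.\<close>
  proof (cases "distinct (awalk_verts (head G e) es)")
    case True
    with p have "distinct (tl (awalk_verts u p))" by simp
    with less.prems p show ?thesis unfolding cycle_def by blast
  next
    case False
    obtain q r s w where qrs: "es = q @ r @ s" "awalk (head G e) q w"
      "awalk w r w" "awalk w s u" "closed_w r"
      using awalk_cyc_decompE'[OF e(3) False] by metis
    have "awalk u (e # q @ s) u"
      using e(1,2) awalk_appendI[OF qrs(2,4)] by (simp add: awalk_Cons_iff del: awalk_append_iff)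
    moreover have "0 < length r" using qrs(5) by (simp add: closed_w_def)
    moreover have "odd (length r) \<or> odd (length (e # q @ s))"
      using less.prems(2) p qrs(1) by auto
    moreover have "length r < length p" using p qrs(1) by simp
    moreover have "length (e # q @ s) < length p" using p qrs(1) \<open>0 < length r\<close> by simp
    ultimately show ?thesis using less.hyps qrs(3) by blast
  qed
qed

lemma (in pair_sym_digraph) awalk_reverse:
  assumes "awalk u p v"
  shows "\<exists>q. awalk v q u \<and> length q = length p"
  using assms
proof (induction p arbitrary: u)
  case Nil
  then show ?case by (auto simp: awalk_Nil_iff)
next
  case (Cons e es)
  then have e: "e \<in> parcs G" "u = fst e" "awalk (snd e) es v" by (auto simp: awalk_Cons_iff)
  from Cons.IH[OF e(3)] obtain q where q: "awalk v q (snd e)" "length q = length es" by blast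
  have "(snd e, fst e) \<in> parcs G" using e(1) arcs_symmetric by (cases e) auto
  then have "awalk (snd e) [(snd e, fst e)] u"
    using e(2) arc_implies_awalk[of "(snd e, fst e)"] by simp
  from awalk_appendI[OF q(1) this] have "awalk v (q @ [(snd e, fst e)]) u" .
  with q(2) show ?case by (metis length_append_singleton length_Cons)
qed

text \<open>This is the form in which connectedness is used to grow a path out of a small vertex
  set.\<close>

lemma (in wf_digraph) awalk_crossing_arc:
  assumes "awalk u p v" "u \<in> S" "v \<notin> S"
  shows "\<exists>e\<in>arcs G. tail G e \<in> S \<and> head G e \<notin> S"
  using assms by (induction p arbitrary: u) (auto simp: awalk_simps)

context pair_graph
begin

text \<open>\<open>connected\<close> speaks of the symmetric closure, which adds no reachability
  because the arcs of \<open>G\<close> are already symmetric.\<close>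

lemma tree_awalk:
  assumes "undirected_tree G" "u \<in> pverts G" "v \<in> pverts G"
  shows "\<exists>p. awalk u p v"
proof -
  have "u \<rightarrow>\<^sup>*\<^bsub>with_proj (mk_symmetric G)\<^esub> v"
    using assms unfolding undirected_tree_def connected_def strongly_connected_def by auto
  then show ?thesis
    using reachable_mk_symmetric_eq[OF sym_arcs] reachable_awalk by auto
qed

lemma tree_no_triangle:
  assumes "undirected_tree G" "(x, y) \<in> parcs G" "(y, z) \<in> parcs G"
  shows "(x, z) \<notin> parcs G"
proof
  assume "(x, z) \<in> parcs G"
  then have "(z, x) \<in> parcs G" by (rule arcs_symmetric)
  moreover have "x \<noteq> y" "y \<noteq> z" "z \<noteq> x"
    using assms(2,3) \<open>(x, z) \<in> parcs G\<close> by (auto dest: no_loops')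
  ultimately have "cycle [(x, y), (y, z), (z, x)]"
    using assms(2,3) unfolding cycle_def
    by (intro exI[of _ x]) (auto simp: awalk_simps dest: in_arcsD1 in_arcsD2)
  then show False
    using assms(1) unfolding undirected_tree_def undirected_cycle_def by force
qed

text \<open>Sets of one or two vertices are proper, so an arc leaves each of them: first from
  \<open>{r}\<close> to some \<open>a\<close>, then from \<open>{r, a}\<close> to a third
  vertex.\<close>

lemma tree_path_of_length_2:
  assumes "undirected_tree G" "3 \<le> card (pverts G)"
  obtains x y z where "(x, y) \<in> parcs G" "(y, z) \<in> parcs G" "x \<noteq> z"
proof -
  have escape: "\<exists>s t. (s, t) \<in> parcs G \<and> s \<in> S \<and> t \<notin> S"
    if S: "S \<subseteq> pverts G" "S \<noteq> {}" "card S < 3" for S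
  proof -
    from S(2) obtain u where "u \<in> S" by blast
    have "S \<noteq> pverts G" using S(3) assms(2) by auto
    then obtain v where "v \<in> pverts G" "v \<notin> S" using S(1) by blast
    with \<open>u \<in> S\<close> S(1) tree_awalk[OF assms(1)] obtain p where "awalk u p v" by blast
    from awalk_crossing_arc[OF this \<open>u \<in> S\<close> \<open>v \<notin> S\<close>] show ?thesis by force
  qed
  have "pverts G \<noteq> {}" using assms(2) by auto
  then obtain r where "r \<in> pverts G" by blast
  with escape[of "{r}"] obtain a where a: "(r, a) \<in> parcs G" "a \<noteq> r" by auto
  then have "a \<in> pverts G" by (auto dest: in_arcsD2)
  with escape[of "{r, a}"] \<open>r \<in> pverts G\<close> a(2) obtain s t
    where st: "(s, t) \<in> parcs G" "s \<in> {r, a}" "t \<notin> {r, a}" by auto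
  show thesis
  \<comment> \<open>The endpoint where the second arc starts becomes the middle of the path.\<close>
  proof (cases "s = a")
    case True
    with that[of r a t] a(1) st show thesis by auto
  next
    case False
    with that[of a r t] arcs_symmetric[OF a(1)] st show thesis by auto
  qed
qed

lemma tree_two_colorable:
  assumes "undirected_tree G"
  shows "\<exists>c. proper_coloring G 2 c"
proof -
  have "pverts G \<noteq> {}"
    using assms unfolding undirected_tree_def connected_def strongly_connected_def by auto
  then obtain r where r: "r \<in> pverts G" by blast
  \<comment> \<open>Uniqueness of the parity need not be known beforehand: equal colours yield walks
    of equal parity to both vertices, even ones for colour 0 and odd ones for colour 1.\<close>
  define c :: "'a \<Rightarrow> nat"
    where "c v = (if \<exists>p. awalk r p v \<and> even (length p) then 0 else 1)" for v
  have "c u \<noteq> c v" if uv: "(u, v) \<in> parcs G" for u v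
  proof
    assume eq: "c u = c v"
    have "u \<in> pverts G" "v \<in> pverts G" using uv by (auto dest: in_arcsD1 in_arcsD2)
    then have "\<exists>p. awalk r p u" "\<exists>q. awalk r q v" using tree_awalk[OF assms r] by auto
    with eq obtain p q where pq: "awalk r p u" "awalk r q v" "even (length p) = even (length q)"
      unfolding c_def by (auto split: if_splits)
    from awalk_reverse[OF pq(2)] obtain q' where q': "awalk v q' r" "length q' = length q" by blast
    have "awalk u ((u, v) # q') r" using uv q'(1) by (simp add: awalk_Cons_iff)
    from awalk_appendI[OF pq(1) this] have "awalk r (p @ (u, v) # q') r" .
    moreover have "odd (length (p @ (u, v) # q'))" using pq(3) q'(2) by simp
    ultimately obtain d where d: "cycle d" "odd (length d)"
      using odd_closed_awalk_imp_odd_cycle by blast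
    \<comment> \<open>A cycle of length 1 would be a loop. Length 2, an edge run back and forth, is
      excluded by parity.\<close>
    have "length d \<noteq> 1"
      using d(1) by (auto simp: cycle_def length_Suc_conv awalk_simps dest: no_loops')
    with d(2) have "3 \<le> length d" by presburger
    with d(1) assms show False unfolding undirected_tree_def undirected_cycle_def by blast
  qed
  moreover have "c ` pverts G \<subseteq> {..<2}" by (auto simp: c_def)
  ultimately show ?thesis unfolding proper_coloring_def by auto
qed

lemma finite_clique_cards: "finite {card C | C. clique G C}"
proof -
  have "finite (card ` Pow (pverts G))" by simp
  then show ?thesis by (rule rev_finite_subset) (auto simp: clique_def)
qed

lemma card_clique_le_clique_number:
  assumes "clique G C"
  shows "card C \<le> clique_number G"
  unfolding clique_number_def using assms finite_clique_cards by (auto intro: Max_ge)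

text \<open>A proper colouring is injective on a clique.\<close>

lemma card_clique_le_chromatic_number:
  assumes "clique G C"
  shows "card C \<le> chromatic_number G"
proof -
  \<comment> \<open>Numbering the vertices injectively gives some proper colouring, so the
    \<open>LEAST\<close> in \<open>chromatic_number\<close> is attained.\<close>
  obtain f :: "'a \<Rightarrow> nat" and n where f: "f ` pverts G = {i. i < n}" "inj_on f (pverts G)"
    using finite_imp_inj_to_nat_seg[OF pair_finite_verts] by blast
  have "f u \<noteq> f v" if "(u, v) \<in> parcs G" for u v
    using that f(2) in_arcsD1 in_arcsD2 no_loops' by (metis inj_on_eq_iff)
  then have "proper_coloring G n f" using f(1) unfolding proper_coloring_def by auto
  then have "\<exists>c. proper_coloring G n c" by blast
  then have "\<exists>c. proper_coloring G (chromatic_number G) c"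
    unfolding chromatic_number_def by (rule LeastI)
  then obtain c where c: "proper_coloring G (chromatic_number G) c" by blast
  have "inj_on c C"
    using assms c unfolding clique_def proper_coloring_def inj_on_def by blast
  moreover have "c ` C \<subseteq> {..<chromatic_number G}"
    using assms c unfolding clique_def proper_coloring_def by blast
  ultimately show ?thesis using card_inj_on_le[of c C "{..<chromatic_number G}"] by simp
qed

lemma tree_clique_number_le_2:
  assumes "undirected_tree G"
  shows "clique_number G \<le> 2"
proof -
  have "card C \<le> 2" if C: "clique G C" for C
  proof (rule ccontr)
    assume "\<not> card C \<le> 2"
    then have "3 \<le> card C" by simp
    then obtain T where "T \<subseteq> C" "card T = 3" by (meson obtain_subset_with_card_n)
    then obtain x y z where "{x, y, z} \<subseteq> C" "x \<noteq> y" "y \<noteq> z" "x \<noteq> z"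
      by (auto simp: card_3_iff)
    with C tree_no_triangle[OF assms, of x y z] show False by (auto simp: clique_def)
  qed
  \<comment> \<open>The bound on \<open>Max\<close> requires a nonempty set of clique sizes.\<close>
  moreover have "clique G {}" by (simp add: clique_def)
  then have "{card C | C. clique G C} \<noteq> {}" by blast
  ultimately show ?thesis
    unfolding clique_number_def using finite_clique_cards by (subst Max_le_iff) auto
qed

end

theorem proposition5:
  fixes G :: "'a pair_pre_digraph"
  assumes "pair_graph G"
    and "undirected_tree G"
    and "3 \<le> card (pverts G)"
  shows "\<not> unfrozen clique_number G \<and> \<not> unfrozen chromatic_number G"
proof -
  interpret pair_graph G by fact
  obtain x y z where xyz: "(x, y) \<in> parcs G" "(y, z) \<in> parcs G" "x \<noteq> z"
    using tree_path_of_length_2[OF assms(2,3)] .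
  then have verts: "x \<in> pverts G" "y \<in> pverts G" "z \<in> pverts G"
    by (auto dest: in_arcsD1 in_arcsD2)
  have "nonedge G x z"
    using verts xyz tree_no_triangle[OF assms(2) xyz(1,2)] by (simp add: nonedge_def)
  \<comment> \<open>The clique bounds are needed for the enlarged graph, where \<open>x\<close>,
    \<open>y\<close>, \<open>z\<close> form a triangle.\<close>
  then interpret H: pair_graph "add_edge G x z"
    by (rule pair_graph_add_edge[OF assms(1)])
  have "clique (add_edge G x z) {x, y, z}"
    using verts xyz arcs_symmetric by (auto simp: clique_def add_edge_def)
  moreover have "x \<noteq> y" "y \<noteq> z" using xyz by (auto dest: no_loops')
  then have "card {x, y, z} = 3" using xyz(3) by simp
  ultimately have "3 \<le> clique_number (add_edge G x z)" "3 \<le> chromatic_number (add_edge G x z)"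
    using H.card_clique_le_clique_number H.card_clique_le_chromatic_number by metis+
  moreover have "chromatic_number G \<le> 2"
    unfolding chromatic_number_def using tree_two_colorable[OF assms(2)] by (rule Least_le)
  moreover note tree_clique_number_le_2[OF assms(2)]
  ultimately show ?thesis using \<open>nonedge G x z\<close> unfolding unfrozen_def by fastforce
qed

end
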